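(* Let $X$ be an F-$\mathbb{BC}$ module and let $S$ be a set. For each $s\in S$ let $(Y_s,\|\cdot\|_{\mathbb{D},s})$ be a hyperbolic normed space and let $T_s:X\to Y_s$ be a continuous $\mathbb{BC}$-linear map. Suppose that for each $x\in X$ the set $\{\|T_s(x)\|_{\mathbb{D},s}:s\in S\}$ is $\mathbb{D}$-bounded. Then the set $\{\|T_s\|_{\mathbb{D}}:s\in S\}$ is $\mathbb{D}$-bounded.
   Context: Bicomplex and hyperbolic numbers. $\mathbb{BC}=\{z_1+z_2 j : z_1,z_2\in\mathbb{C}(i)\}$ with $i^2=j^2=-1$, $ij=ji=k$ (so $k^2=1$); it is a commutative ring. $\mathbb{D}=\{\beta_1+k\beta_2:\beta_1,\beta_2\in\mathbb{R}\}\subset\mathbb{BC}$ is the ring of hyperbolic numbers. With $e_1=\frac{1+k}{2}$, $e_2=\frac{1-k}{2}$ one has $e_1^2=e_1$, $e_2^2=e_2$, $e_1+e_2=1$, $e_1e_2=0$, and each $Z\in\mathbb{BC}$ is uniquely $Z=e_1z_1+e_2z_2$ with $z_1,z_2\in\mathbb{C}(i)$; $Z\in\mathbb{D}$ iff $z_1,z_2$ are real. Put $|Z|_k=e_1|z_1|+e_2|z_2|$. Let $\mathbb{D}^+=\{e_1\alpha_1+e_2\alpha_2:\alpha_1,\alpha_2\ge 0\}$. The partial order on $\mathbb{D}$ is $\alpha\le\beta$ iff $\beta-\alpha\in\mathbb{D}^+$; suprema are taken for this order (equivalently, componentwise in $e_1,e_2$). Convergence in $\mathbb{D}$ is componentwise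 with respect to $e_1,e_2$. A set $A\subset\mathbb{D}^+$ is $\mathbb{D}$-bounded if there is $M\in\mathbb{D}^+$ with $\alpha\le M$ for all $\alpha\in A$. Norms. A hyperbolic norm on a $\mathbb{BC}$-module $X$ is a map $\|\cdot\|_{\mathbb{D}}:X\to\mathbb{D}^+$ with $\|x\|_{\mathbb{D}}=0$ iff $x=0$; $\|\mu x\|_{\mathbb{D}}=|\mu|_k\|x\|_{\mathbb{D}}$ for $\mu\in\mathbb{BC}$; and $\|x+y\|_{\mathbb{D}}\le\|x\|_{\mathbb{D}}+\|y\|_{\mathbb{D}}$. A hyperbolic normed space is a $\mathbb{BC}$-module with a hyperbolic norm. $x_n\to x$ means $\|x_n-x\|_{\mathbb{D}}\to 0$ in $\mathbb{D}$. An F-$\mathbb{BC}$ module is a hyperbolic normed space in which every Cauchy sequence converges. Maps. $T:X\to Y$ is $\mathbb{BC}$-linear if $T(x+y)=T(x)+T(y)$ and $T(\mu x)=\mu T(x)$ for $x,y\in X$, $\mu\in\mathbb{BC}$; it is continuous if $x_n\to x$ implies $Tx_n\to Tx$. For a continuous $\mathbb{BC}$-linear map, $\|T\|_{\mathbb{D}}=\sup\{\|Tx\|_{\mathbb{D}}: x\in X,\ \|x\|_{\mathbb{D}}\le 1\}\in\mathbb{D}^+$. *)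

theory Defs
  imports Complex_Main "HOL-Algebra.Module"
begin

section \<open>Bicomplex numbers\<close>

text \<open>\<open>Bicomplex z1 z2\<close> is the number \<open>z1 + z2 j\<close>, where \<open>z1\<close> and \<open>z2\<close> are complex
  numbers with imaginary unit \<open>i\<close>.\<close>

codatatype bicomplex = Bicomplex (Bc1: complex) (Bc2: complex)

lemma bicomplex_eq_iff: "x = y \<longleftrightarrow> Bc1 x = Bc1 y \<and> Bc2 x = Bc2 y"
  by (auto intro: bicomplex.expand)

instantiation bicomplex :: comm_ring_1
begin

primcorec zero_bicomplex where
  "Bc1 0 = 0"
| "Bc2 0 = 0"

primcorec one_bicomplex where
  "Bc1 1 = 1"
| "Bc2 1 = 0"

primcorec plus_bicomplex where
  "Bc1 (x + y) = Bc1 x + Bc1 y"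
| "Bc2 (x + y) = Bc2 x + Bc2 y"

primcorec uminus_bicomplex where
  "Bc1 (- x) = - Bc1 x"
| "Bc2 (- x) = - Bc2 x"

primcorec minus_bicomplex where
  "Bc1 (x - y) = Bc1 x - Bc1 y"
| "Bc2 (x - y) = Bc2 x - Bc2 y"

primcorec times_bicomplex where
  "Bc1 (x * y) = Bc1 x * Bc1 y - Bc2 x * Bc2 y"
| "Bc2 (x * y) = Bc1 x * Bc2 y + Bc2 x * Bc1 y"

instance
  by standard (simp_all add: bicomplex_eq_iff algebra_simps)

end

lemma Bc_numeral [simp]: "Bc1 (numeral w) = numeral w" "Bc2 (numeral w) = 0"
  by (induction w) (simp_all only: numeral.simps plus_bicomplex.sel one_bicomplex.sel add_0_left)

definition bc_of_complex :: "complex \<Rightarrow> bicomplex" where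
  "bc_of_complex z = Bicomplex z 0"

abbreviation bc_of_real :: "real \<Rightarrow> bicomplex" where
  "bc_of_real r \<equiv> bc_of_complex (complex_of_real r)"

definition bc_i :: bicomplex where "bc_i = bc_of_complex \<i>"
definition bc_j :: bicomplex where "bc_j = Bicomplex 0 1"
definition bc_k :: bicomplex where "bc_k = bc_i * bc_j"

definition bc_e1 :: bicomplex where "bc_e1 = bc_of_real (1/2) * (1 + bc_k)"
definition bc_e2 :: bicomplex where "bc_e2 = bc_of_real (1/2) * (1 - bc_k)"

lemmas bc_unit_defs = bc_of_complex_def bc_i_def bc_j_def bc_k_def bc_e1_def bc_e2_def

lemma Bicomplex_eq: "Bicomplex z1 z2 = bc_of_complex z1 + bc_of_complex z2 * bc_j"
  by (simp add: bicomplex_eq_iff bc_unit_defs)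

lemma bc_units:
  "bc_i * bc_i = -1" "bc_j * bc_j = -1" "bc_j * bc_i = bc_k" "bc_k * bc_k = 1"
  "bc_e1 * bc_e1 = bc_e1" "bc_e2 * bc_e2 = bc_e2" "bc_e1 + bc_e2 = 1" "bc_e1 * bc_e2 = 0"
  by (simp_all add: bicomplex_eq_iff bc_unit_defs algebra_simps)

text \<open>The idempotent components: \<open>Z = e1 z1 + e2 z2\<close> holds exactly for \<open>z1 = bc_comp1 Z\<close> and
  \<open>z2 = bc_comp2 Z\<close>. The formulas come from \<open>j e1 = -i e1\<close> and \<open>j e2 = i e2\<close>.\<close>

definition bc_comp1 :: "bicomplex \<Rightarrow> complex" where "bc_comp1 Z = Bc1 Z - \<i> * Bc2 Z"
definition bc_comp2 :: "bicomplex \<Rightarrow> complex" where "bc_comp2 Z = Bc1 Z + \<i> * Bc2 Z"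

lemma bc_comp_sum [simp]:
  "bc_comp1 (bc_e1 * bc_of_complex z1 + bc_e2 * bc_of_complex z2) = z1"
  "bc_comp2 (bc_e1 * bc_of_complex z1 + bc_e2 * bc_of_complex z2) = z2"
  by (simp_all add: bc_unit_defs bc_comp1_def bc_comp2_def algebra_simps)

lemma bc_comp_decomp:
  "Z = bc_e1 * bc_of_complex (bc_comp1 Z) + bc_e2 * bc_of_complex (bc_comp2 Z)"
  by (simp add: bicomplex_eq_iff bc_unit_defs bc_comp1_def bc_comp2_def algebra_simps)

lemma bc_comp_unique:
  "Z = bc_e1 * bc_of_complex z1 + bc_e2 * bc_of_complex z2
    \<longleftrightarrow> z1 = bc_comp1 Z \<and> z2 = bc_comp2 Z"
  using bc_comp_decomp[of Z] by auto

definition bc_abs :: "bicomplex \<Rightarrow> bicomplex" where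
  "bc_abs Z = bc_e1 * bc_of_real (cmod (bc_comp1 Z)) + bc_e2 * bc_of_real (cmod (bc_comp2 Z))"

definition BC_ring :: "bicomplex ring" where
  "BC_ring = \<lparr>carrier = UNIV, mult = (*), one = 1, zero = 0, add = (+)\<rparr>"

lemma cring_BC_ring: "cring BC_ring"
proof -
  have "\<exists>y. y + x = 0 \<and> x + y = 0" for x :: bicomplex
    by (rule exI[of _ "- x"]) simp
  then show ?thesis
    unfolding BC_ring_def by unfold_locales (auto simp: algebra_simps Units_def)
qed


section \<open>Hyperbolic numbers\<close>

definition hyp :: "bicomplex set" where
  "hyp = {bc_of_real b1 + bc_k * bc_of_real b2 | b1 b2. True}"

definition hyp_pos :: "bicomplex set" where
  "hyp_pos = {bc_e1 * bc_of_real a1 + bc_e2 * bc_of_real a2 | a1 a2. 0 \<le> a1 \<and> 0 \<le> a2}"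

lemma hyp_iff: "Z \<in> hyp \<longleftrightarrow> bc_comp1 Z \<in> \<real> \<and> bc_comp2 Z \<in> \<real>"
proof
  assume "Z \<in> hyp"
  then show "bc_comp1 Z \<in> \<real> \<and> bc_comp2 Z \<in> \<real>"
    by (auto simp: hyp_def bc_unit_defs bc_comp1_def bc_comp2_def)
next
  assume "bc_comp1 Z \<in> \<real> \<and> bc_comp2 Z \<in> \<real>"
  then obtain a b where ab: "bc_comp1 Z = of_real a" "bc_comp2 Z = of_real b"
    by (auto elim!: Reals_cases)
  have "Z = bc_of_real ((a + b) / 2) + bc_k * bc_of_real ((a - b) / 2)"
    by (subst bc_comp_decomp[of Z])
      (simp add: ab bicomplex_eq_iff bc_unit_defs field_simps)
  then show "Z \<in> hyp" unfolding hyp_def by blast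
qed

lemma hyp_pos_subset_hyp: "hyp_pos \<subseteq> hyp"
  by (auto simp: hyp_pos_def hyp_iff)

definition hyp_le :: "bicomplex \<Rightarrow> bicomplex \<Rightarrow> bool" where
  "hyp_le a b \<longleftrightarrow> b - a \<in> hyp_pos"

definition hyp_is_sup :: "bicomplex set \<Rightarrow> bicomplex \<Rightarrow> bool" where
  "hyp_is_sup A s \<longleftrightarrow> s \<in> hyp \<and> (\<forall>a\<in>A. hyp_le a s) \<and>
     (\<forall>u\<in>hyp. (\<forall>a\<in>A. hyp_le a u) \<longrightarrow> hyp_le s u)"

definition hyp_Sup :: "bicomplex set \<Rightarrow> bicomplex" where
  "hyp_Sup A = (THE s. hyp_is_sup A s)"

definition hyp_bounded :: "bicomplex set \<Rightarrow> bool" where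
  "hyp_bounded A \<longleftrightarrow> A \<subseteq> hyp_pos \<and> (\<exists>M\<in>hyp_pos. \<forall>a\<in>A. hyp_le a M)"

definition hyp_tendsto :: "('a \<Rightarrow> bicomplex) \<Rightarrow> bicomplex \<Rightarrow> 'a filter \<Rightarrow> bool" where
  "hyp_tendsto f l F \<longleftrightarrow>
     ((\<lambda>n. bc_comp1 (f n)) \<longlongrightarrow> bc_comp1 l) F \<and> ((\<lambda>n. bc_comp2 (f n)) \<longlongrightarrow> bc_comp2 l) F"


section \<open>Hyperbolic normed spaces and linear maps\<close>

text \<open>As for every module record of HOL-Algebra, the fields \<open>mult\<close> and \<open>one\<close> are irrelevant.\<close>

record 'x hyp_normed = "(bicomplex, 'x) module" +
  hnorm :: "'x \<Rightarrow> bicomplex"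

locale hyperbolic_normed_space = module BC_ring X for X (structure) +
  assumes hnorm_in_hyp_pos: "x \<in> carrier X \<Longrightarrow> hnorm X x \<in> hyp_pos"
    and hnorm_eq_0_iff: "x \<in> carrier X \<Longrightarrow> hnorm X x = 0 \<longleftrightarrow> x = \<zero>\<^bsub>X\<^esub>"
    and hnorm_smult: "x \<in> carrier X \<Longrightarrow> hnorm X (\<mu> \<odot>\<^bsub>X\<^esub> x) = bc_abs \<mu> * hnorm X x"
    and hnorm_triangle: "x \<in> carrier X \<Longrightarrow> y \<in> carrier X \<Longrightarrow>
      hyp_le (hnorm X (x \<oplus>\<^bsub>X\<^esub> y)) (hnorm X x + hnorm X y)"

definition hyp_converges :: "('x, 'm) hyp_normed_scheme \<Rightarrow> (nat \<Rightarrow> 'x) \<Rightarrow> 'x \<Rightarrow> bool" where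
  "hyp_converges X x l \<longleftrightarrow> hyp_tendsto (\<lambda>n. hnorm X (x n \<ominus>\<^bsub>X\<^esub> l)) 0 sequentially"

text \<open>The norm of \<open>x m - x n\<close> tends to \<open>0\<close> as \<open>m\<close> and \<open>n\<close> tend to infinity independently.\<close>

definition hyp_Cauchy :: "('x, 'm) hyp_normed_scheme \<Rightarrow> (nat \<Rightarrow> 'x) \<Rightarrow> bool" where
  "hyp_Cauchy X x \<longleftrightarrow>
     hyp_tendsto (\<lambda>(m, n). hnorm X (x m \<ominus>\<^bsub>X\<^esub> x n)) 0 (sequentially \<times>\<^sub>F sequentially)"

locale F_BC_module = hyperbolic_normed_space +
  assumes complete: "(\<And>n. x n \<in> carrier X) \<Longrightarrow> hyp_Cauchy X x \<Longrightarrow>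
    \<exists>l\<in>carrier X. hyp_converges X x l"

definition BC_linear ::
  "('x, 'm) hyp_normed_scheme \<Rightarrow> ('y, 'n) hyp_normed_scheme \<Rightarrow> ('x \<Rightarrow> 'y) \<Rightarrow> bool" where
  "BC_linear X Y T \<longleftrightarrow> T \<in> carrier X \<rightarrow> carrier Y \<and>
     (\<forall>x\<in>carrier X. \<forall>y\<in>carrier X. T (x \<oplus>\<^bsub>X\<^esub> y) = T x \<oplus>\<^bsub>Y\<^esub> T y) \<and>
     (\<forall>\<mu>. \<forall>x\<in>carrier X. T (\<mu> \<odot>\<^bsub>X\<^esub> x) = \<mu> \<odot>\<^bsub>Y\<^esub> T x)"

definition hyp_continuous ::
  "('x, 'm) hyp_normed_scheme \<Rightarrow> ('y, 'n) hyp_normed_scheme \<Rightarrow> ('x \<Rightarrow> 'y) \<Rightarrow> bool" where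
  "hyp_continuous X Y T \<longleftrightarrow>
     (\<forall>x. \<forall>l\<in>carrier X. (\<forall>n. x n \<in> carrier X) \<longrightarrow> hyp_converges X x l
        \<longrightarrow> hyp_converges Y (\<lambda>n. T (x n)) (T l))"

definition hyp_opnorm ::
  "('x, 'm) hyp_normed_scheme \<Rightarrow> ('y, 'n) hyp_normed_scheme \<Rightarrow> ('x \<Rightarrow> 'y) \<Rightarrow> bicomplex" where
  "hyp_opnorm X Y T = hyp_Sup {hnorm Y (T x) | x. x \<in> carrier X \<and> hyp_le (hnorm X x) 1}"

end

theory Submission
  imports Defs "HOL-Analysis.Urysohn"
begin

text \<open>The sum of the two idempotent components of a hyperbolic norm is a real norm inducing the same
  convergence, so an F-BC module is a complete metric space. By the Baire category theorem
  one of the closed sets \<open>{x. \<forall>s. \<parallel>T\<^sub>s x\<parallel> \<le> n}\<close> contains a ball, and by linearity the \<open>T\<^sub>s\<close> are uniformly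
  bounded on a ball around \<open>0\<close>, hence, by real scaling, on the unit ball of the hyperbolic norm.\<close>

section \<open>Hyperbolic order and suprema in idempotent components\<close>

text \<open>Sending \<open>bc_j\<close> to \<open>-\<i>\<close> and to \<open>\<i>\<close> gives two
  ring homomorphisms to the complex numbers, so bicomplex computations split into two independent
  complex ones.\<close>

lemma bc_comp_simps [simp]:
  "bc_comp1 0 = 0" "bc_comp2 0 = 0"
  "bc_comp1 1 = 1" "bc_comp2 1 = 1"
  "bc_comp1 (a + b) = bc_comp1 a + bc_comp1 b" "bc_comp2 (a + b) = bc_comp2 a + bc_comp2 b"
  "bc_comp1 (a - b) = bc_comp1 a - bc_comp1 b" "bc_comp2 (a - b) = bc_comp2 a - bc_comp2 b"
  "bc_comp1 (- a) = - bc_comp1 a" "bc_comp2 (- a) = - bc_comp2 a"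
  "bc_comp1 (a * b) = bc_comp1 a * bc_comp1 b" "bc_comp2 (a * b) = bc_comp2 a * bc_comp2 b"
  "bc_comp1 (bc_of_complex z) = z" "bc_comp2 (bc_of_complex z) = z"
  by (simp_all add: bc_comp1_def bc_comp2_def bc_of_complex_def algebra_simps)

lemma bc_comp_abs [simp]:
  "bc_comp1 (bc_abs a) = of_real (cmod (bc_comp1 a))"
  "bc_comp2 (bc_abs a) = of_real (cmod (bc_comp2 a))"
  unfolding bc_abs_def by (simp_all only: bc_comp_sum)

lemma bc_eqI: "bc_comp1 a = bc_comp1 b \<Longrightarrow> bc_comp2 a = bc_comp2 b \<Longrightarrow> a = b"
  using bc_comp_decomp[of a] bc_comp_decomp[of b] by simp

lemma hyp_pos_iff:
  "Z \<in> hyp_pos \<longleftrightarrow> 0 \<le> Re (bc_comp1 Z) \<and> 0 \<le> Re (bc_comp2 Z) \<and>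
     Im (bc_comp1 Z) = 0 \<and> Im (bc_comp2 Z) = 0"
proof
  assume "0 \<le> Re (bc_comp1 Z) \<and> 0 \<le> Re (bc_comp2 Z) \<and> Im (bc_comp1 Z) = 0 \<and> Im (bc_comp2 Z) = 0"
  moreover from this have "Z = bc_e1 * bc_of_real (Re (bc_comp1 Z)) + bc_e2 * bc_of_real (Re (bc_comp2 Z))"
    by (simp only: bc_comp_unique) (simp add: complex_eq_iff)
  ultimately show "Z \<in> hyp_pos"
    unfolding hyp_pos_def by blast
next
  assume "Z \<in> hyp_pos"
  then show "0 \<le> Re (bc_comp1 Z) \<and> 0 \<le> Re (bc_comp2 Z) \<and>
     Im (bc_comp1 Z) = 0 \<and> Im (bc_comp2 Z) = 0"
    unfolding hyp_pos_def by (auto simp only: bc_comp_sum Re_complex_of_real Im_complex_of_real)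
qed

lemma hyp_iff_Im: "Z \<in> hyp \<longleftrightarrow> Im (bc_comp1 Z) = 0 \<and> Im (bc_comp2 Z) = 0"
  by (simp add: hyp_iff complex_is_Real_iff)

text \<open>The order is defined on all bicomplex numbers, so imaginary parts have to agree rather
  than vanish; on \<open>hyp\<close> this is the componentwise real order.\<close>

lemma hyp_le_iff:
  "hyp_le a b \<longleftrightarrow> Re (bc_comp1 a) \<le> Re (bc_comp1 b) \<and> Re (bc_comp2 a) \<le> Re (bc_comp2 b) \<and>
     Im (bc_comp1 a) = Im (bc_comp1 b) \<and> Im (bc_comp2 a) = Im (bc_comp2 b)"
  by (auto simp: hyp_le_def hyp_pos_iff)

lemma hyp_le_antisym: "hyp_le a b \<Longrightarrow> hyp_le b a \<Longrightarrow> a = b"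
  by (intro bc_eqI complex_eqI) (auto simp: hyp_le_iff)

lemma hyp_Sup_eqI: "hyp_is_sup A s \<Longrightarrow> hyp_Sup A = s"
  unfolding hyp_Sup_def
  by (rule the_equality) (auto simp: hyp_is_sup_def intro: hyp_le_antisym)

text \<open>\<open>hyp_Sup\<close> is a definite description, so a supremum must first be exhibited.
  For a product order it is the pair of real suprema, which exist because \<open>A\<close> is
  nonempty and bounded.\<close>

lemma hyp_is_sup_Sup:
  assumes "A \<noteq> {}" "A \<subseteq> hyp" "M \<in> hyp" "\<And>a. a \<in> A \<Longrightarrow> hyp_le a M"
  shows "hyp_is_sup A (hyp_Sup A)"
proof -
  define f1 f2 where "f1 = (\<lambda>a. Re (bc_comp1 a))" and "f2 = (\<lambda>a. Re (bc_comp2 a))"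
  define s where "s = bc_e1 * bc_of_real (Sup (f1 ` A)) + bc_e2 * bc_of_real (Sup (f2 ` A))"
  have s: "bc_comp1 s = Sup (f1 ` A)" "bc_comp2 s = Sup (f2 ` A)"
    unfolding s_def by (simp_all only: bc_comp_sum)
  have "bdd_above (f1 ` A)" "bdd_above (f2 ` A)"
    using assms(4) by (auto simp: f1_def f2_def hyp_le_iff intro!: bdd_aboveI2)
  then have upper: "f1 a \<le> Sup (f1 ` A)" "f2 a \<le> Sup (f2 ` A)" if "a \<in> A" for a
    using that by (auto intro: cSUP_upper)
  have least: "Sup (f1 ` A) \<le> f1 u" "Sup (f2 ` A) \<le> f2 u" if "\<forall>a\<in>A. hyp_le a u" for u
    using that assms(1) by (auto simp: f1_def f2_def hyp_le_iff intro!: cSUP_least)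
  have "hyp_is_sup A s"
    using assms(2) upper least
    by (auto simp: hyp_is_sup_def hyp_le_iff hyp_iff_Im s f1_def f2_def subset_iff)
  then show ?thesis
    by (simp add: hyp_Sup_eqI)
qed

section \<open>The associated real norm\<close>

lemma carrier_BC_ring [simp]: "carrier BC_ring = UNIV"
  by (simp add: BC_ring_def)

lemma a_inv_one_BC_ring: "\<ominus>\<^bsub>BC_ring\<^esub> \<one>\<^bsub>BC_ring\<^esub> = - 1"
proof -
  interpret cring BC_ring
    by (rule cring_BC_ring)
  have "(- 1) \<oplus>\<^bsub>BC_ring\<^esub> \<one>\<^bsub>BC_ring\<^esub> = \<zero>\<^bsub>BC_ring\<^esub>"
    by (simp add: BC_ring_def)
  then show ?thesis
    by (intro minus_equality) auto
qed

text \<open>\<open>Re\<close> only changes the type: on the carrier of a hyperbolic normed space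
  both components of \<open>hnorm\<close> are real.\<close>

definition rnorm :: "('x, 'm) hyp_normed_scheme \<Rightarrow> 'x \<Rightarrow> real" where
  "rnorm X x = Re (bc_comp1 (hnorm X x)) + Re (bc_comp2 (hnorm X x))"

context hyperbolic_normed_space
begin

lemma Re_hnorm_nonneg:
  assumes "x \<in> carrier X"
  shows "0 \<le> Re (bc_comp1 (hnorm X x))" "0 \<le> Re (bc_comp2 (hnorm X x))"
  using hnorm_in_hyp_pos[OF assms] by (simp_all add: hyp_pos_iff)

lemma Im_hnorm [simp]:
  assumes "x \<in> carrier X"
  shows "Im (bc_comp1 (hnorm X x)) = 0" "Im (bc_comp2 (hnorm X x)) = 0"
  using hnorm_in_hyp_pos[OF assms] by (simp_all add: hyp_pos_iff)

lemma rnorm_nonneg: "x \<in> carrier X \<Longrightarrow> 0 \<le> rnorm X x"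
  using Re_hnorm_nonneg[of x] by (simp add: rnorm_def)

lemma rnorm_eq_0_iff:
  assumes "x \<in> carrier X"
  shows "rnorm X x = 0 \<longleftrightarrow> x = \<zero>\<^bsub>X\<^esub>"
proof -
  have "rnorm X x = 0 \<longleftrightarrow> hnorm X x = 0"
    using Re_hnorm_nonneg[OF assms] assms
    by (auto simp: rnorm_def add_nonneg_eq_0_iff complex_eq_iff intro!: bc_eqI)
  then show ?thesis
    using hnorm_eq_0_iff[OF assms] by simp
qed

lemma rnorm_triangle:
  "x \<in> carrier X \<Longrightarrow> y \<in> carrier X \<Longrightarrow> rnorm X (x \<oplus>\<^bsub>X\<^esub> y) \<le> rnorm X x + rnorm X y"
  using hnorm_triangle[of x y] by (simp add: rnorm_def hyp_le_iff)

text \<open>A real scalar has the same component twice, so its absolute value factors out of the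
  sum; a general bicomplex scalar would weight the two summands differently.\<close>

lemma rnorm_scaleR:
  "x \<in> carrier X \<Longrightarrow> rnorm X (bc_of_real c \<odot>\<^bsub>X\<^esub> x) = \<bar>c\<bar> * rnorm X x"
  by (simp add: rnorm_def hnorm_smult algebra_simps)

lemma rnorm_minus:
  assumes "x \<in> carrier X"
  shows "rnorm X (\<ominus>\<^bsub>X\<^esub> x) = rnorm X x"
proof -
  \<comment> \<open>The norm axioms mention scalar multiples but not inverses, and
    \<open>bc_abs (- 1)\<close> has both components 1.\<close>
  have "\<ominus>\<^bsub>X\<^esub> x = (- 1) \<odot>\<^bsub>X\<^esub> x"
    using smult_l_minus[of "\<one>\<^bsub>BC_ring\<^esub>" x] smult_one[OF assms] assms
    by (simp add: a_inv_one_BC_ring)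
  then show ?thesis
    using assms by (simp add: rnorm_def hnorm_smult)
qed

lemma rnorm_diff_commute:
  assumes "x \<in> carrier X" "y \<in> carrier X"
  shows "rnorm X (x \<ominus>\<^bsub>X\<^esub> y) = rnorm X (y \<ominus>\<^bsub>X\<^esub> x)"
proof -
  have "x \<ominus>\<^bsub>X\<^esub> y = \<ominus>\<^bsub>X\<^esub> (y \<ominus>\<^bsub>X\<^esub> x)"
    using assms by (simp add: M.minus_eq M.minus_add M.a_comm)
  then show ?thesis
    using assms by (simp add: rnorm_minus)
qed

text \<open>A triangle inequality with the difference oriented as in \<open>hyp_converges\<close>,
  where the limit is the subtrahend.\<close>

lemma rnorm_le_diff:
  assumes "x \<in> carrier X" "y \<in> carrier X"
  shows "rnorm X x \<le> rnorm X y + rnorm X (y \<ominus>\<^bsub>X\<^esub> x)"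
proof -
  have "y \<oplus>\<^bsub>X\<^esub> (x \<ominus>\<^bsub>X\<^esub> y) = x"
    using assms by (simp add: M.minus_eq M.a_lcomm[of y x] M.r_neg)
  then show ?thesis
    using rnorm_triangle[of y "x \<ominus>\<^bsub>X\<^esub> y"] rnorm_diff_commute[of x y] assms by simp
qed

text \<open>Recovers a bound on one summand from bounds on the sum and on the other summand.\<close>

lemma rnorm_le_add:
  assumes "x \<in> carrier X" "y \<in> carrier X"
  shows "rnorm X y \<le> rnorm X (x \<oplus>\<^bsub>X\<^esub> y) + rnorm X x"
proof -
  have "y = (x \<oplus>\<^bsub>X\<^esub> y) \<oplus>\<^bsub>X\<^esub> (\<ominus>\<^bsub>X\<^esub> x)"
    using assms by (simp add: M.a_comm[of x y] M.a_assoc M.r_neg)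
  then show ?thesis
    using rnorm_triangle[of "x \<oplus>\<^bsub>X\<^esub> y" "\<ominus>\<^bsub>X\<^esub> x"] assms by (simp add: rnorm_minus)
qed

section \<open>Convergence, Cauchy sequences and completeness through the real norm\<close>

lemma hyp_tendsto_0_iff_rnorm:
  assumes "\<And>n. f n \<in> carrier X"
  shows "hyp_tendsto (\<lambda>n. hnorm X (f n)) 0 F \<longleftrightarrow> ((\<lambda>n. rnorm X (f n)) \<longlongrightarrow> 0) F"
proof
  assume "hyp_tendsto (\<lambda>n. hnorm X (f n)) 0 F"
  then have "((\<lambda>n. Re (bc_comp1 (hnorm X (f n))) + Re (bc_comp2 (hnorm X (f n)))) \<longlongrightarrow> Re 0 + Re 0) F"
    unfolding hyp_tendsto_def bc_comp_simps by (intro tendsto_add tendsto_Re) auto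
  then show "((\<lambda>n. rnorm X (f n)) \<longlongrightarrow> 0) F"
    by (simp add: rnorm_def)
next
  assume lim: "((\<lambda>n. rnorm X (f n)) \<longlongrightarrow> 0) F"
  \<comment> \<open>Both components are nonnegative, so each is dominated by their sum.\<close>
  have "((\<lambda>n. bc_comp1 (hnorm X (f n))) \<longlongrightarrow> 0) F"
    by (rule Lim_null_comparison[OF _ lim])
      (use assms Re_hnorm_nonneg in \<open>auto simp: rnorm_def cmod_eq_Re\<close>)
  moreover have "((\<lambda>n. bc_comp2 (hnorm X (f n))) \<longlongrightarrow> 0) F"
    by (rule Lim_null_comparison[OF _ lim])
      (use assms Re_hnorm_nonneg in \<open>auto simp: rnorm_def cmod_eq_Re\<close>)
  ultimately show "hyp_tendsto (\<lambda>n. hnorm X (f n)) 0 F"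
    by (simp add: hyp_tendsto_def)
qed

lemma hyp_converges_iff_rnorm:
  assumes "\<And>n. x n \<in> carrier X" "l \<in> carrier X"
  shows "hyp_converges X x l \<longleftrightarrow> (\<lambda>n. rnorm X (x n \<ominus>\<^bsub>X\<^esub> l)) \<longlonglongrightarrow> 0"
  unfolding hyp_converges_def using assms by (intro hyp_tendsto_0_iff_rnorm) simp

text \<open>The locale \<^locale>\<open>Metric_space\<close> asks for nonnegativity and symmetry on the whole type, hence
  the value \<open>0\<close> off the carrier.\<close>

definition rdist :: "'a \<Rightarrow> 'a \<Rightarrow> real" where
  "rdist x y = (if x \<in> carrier X \<and> y \<in> carrier X then rnorm X (x \<ominus>\<^bsub>X\<^esub> y) else 0)"

lemma rdist_eq: "x \<in> carrier X \<Longrightarrow> y \<in> carrier X \<Longrightarrow> rdist x y = rnorm X (x \<ominus>\<^bsub>X\<^esub> y)"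
  by (simp add: rdist_def)

sublocale rmetric: Metric_space "carrier X" rdist
proof
  show "0 \<le> rdist x y" for x y
    by (simp add: rdist_def rnorm_nonneg)
  show "rdist x y = rdist y x" for x y
    by (simp add: rdist_def rnorm_diff_commute)
  show "rdist x y = 0 \<longleftrightarrow> x = y" if "x \<in> carrier X" "y \<in> carrier X" for x y
  proof -
    have "x \<ominus>\<^bsub>X\<^esub> y = \<zero>\<^bsub>X\<^esub> \<longleftrightarrow> x = y"
      using that by (auto simp: M.minus_eq M.r_neg dest: M.minus_equality)
    then show ?thesis
      using that by (simp add: rdist_def rnorm_eq_0_iff)
  qed
  show "rdist x z \<le> rdist x y + rdist y z"
    if "x \<in> carrier X" "y \<in> carrier X" "z \<in> carrier X" for x y z
  proof -
    have "(x \<ominus>\<^bsub>X\<^esub> y) \<oplus>\<^bsub>X\<^esub> (y \<ominus>\<^bsub>X\<^esub> z) = x \<ominus>\<^bsub>X\<^esub> z"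
      using that by (simp add: M.minus_eq M.a_assoc M.r_neg1)
    then show ?thesis
      using rnorm_triangle[of "x \<ominus>\<^bsub>X\<^esub> y" "y \<ominus>\<^bsub>X\<^esub> z"] that by (simp add: rdist_def)
  qed
qed

lemma limitin_rmetric:
  assumes "\<And>n. x n \<in> carrier X"
  shows "limitin rmetric.mtopology x l sequentially \<longleftrightarrow> l \<in> carrier X \<and> hyp_converges X x l"
proof (cases "l \<in> carrier X")
  case True
  then have "(\<lambda>n. rdist (x n) l) \<longlonglongrightarrow> 0 \<longleftrightarrow> hyp_converges X x l"
    using assms by (simp add: hyp_converges_iff_rnorm rdist_eq)
  then show ?thesis
    using True assms by (simp add: rmetric.limitin_metric_dist_null)
qed (simp add: rmetric.limitin_metric_dist_null)

text \<open>A metric Cauchy sequence has one threshold \<open>N\<close> for both indices, which is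
  what an eventuality for the product filter unfolds to.\<close>

lemma MCauchy_rmetric:
  assumes "rmetric.MCauchy x"
  shows "hyp_Cauchy X x"
proof -
  have x: "x n \<in> carrier X" for n
    using assms by (auto simp: rmetric.MCauchy_def)
  have "((\<lambda>p. rnorm X (x (fst p) \<ominus>\<^bsub>X\<^esub> x (snd p))) \<longlongrightarrow> 0) (sequentially \<times>\<^sub>F sequentially)"
  proof (rule tendstoI)
    fix e :: real
    assume "0 < e"
    then obtain N where "\<forall>n n'. N \<le> n \<longrightarrow> N \<le> n' \<longrightarrow> rdist (x n) (x n') < e"
      using assms by (auto simp: rmetric.MCauchy_def)
    then show "\<forall>\<^sub>F p in sequentially \<times>\<^sub>F sequentially.
        dist (rnorm X (x (fst p) \<ominus>\<^bsub>X\<^esub> x (snd p))) 0 < e"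
      unfolding eventually_prod_sequentially
      using x by (intro exI[of _ N]) (auto simp: rdist_eq rnorm_nonneg)
  qed
  then show ?thesis
    unfolding hyp_Cauchy_def split_beta using x by (subst hyp_tendsto_0_iff_rnorm) auto
qed

end

lemma (in F_BC_module) mcomplete_rmetric: "rmetric.mcomplete"
  unfolding rmetric.mcomplete_def
proof (intro allI impI)
  fix x
  assume x: "rmetric.MCauchy x"
  then have "x n \<in> carrier X" for n
    by (auto simp: rmetric.MCauchy_def)
  then show "\<exists>l. limitin rmetric.mtopology x l sequentially"
    using complete[of x] MCauchy_rmetric[OF x] by (auto simp: limitin_rmetric)
qed

section \<open>Uniform boundedness\<close>

text \<open>The norm of \<open>T l\<close> is at most \<open>B\<close> plus the norm of
  \<open>T (x n) - T l\<close>, and the latter tends to 0 by continuity. The sequential form matches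
  both the definition of continuity and the metric criterion for closed sets.\<close>

lemma rnorm_sublevel_closed:
  assumes "hyperbolic_normed_space X" "hyperbolic_normed_space Y"
    and "BC_linear X Y T" "hyp_continuous X Y T"
    and "\<And>n. x n \<in> carrier X" "l \<in> carrier X" "hyp_converges X x l"
    and "\<And>n. rnorm Y (T (x n)) \<le> B"
  shows "rnorm Y (T l) \<le> B"
proof -
  interpret Y: hyperbolic_normed_space Y by fact
  have T: "T z \<in> carrier Y" if "z \<in> carrier X" for z
    using assms(3) that by (auto simp: BC_linear_def)
  have "hyp_converges Y (\<lambda>n. T (x n)) (T l)"
    using assms(4-7) unfolding hyp_continuous_def by blast
  then have "(\<lambda>n. rnorm Y (T (x n) \<ominus>\<^bsub>Y\<^esub> T l)) \<longlonglongrightarrow> 0"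
    using T assms(5,6) by (simp add: Y.hyp_converges_iff_rnorm)
  then have "(\<lambda>n. B + rnorm Y (T (x n) \<ominus>\<^bsub>Y\<^esub> T l)) \<longlonglongrightarrow> B + 0"
    by (intro tendsto_intros)
  moreover have "rnorm Y (T l) \<le> B + rnorm Y (T (x n) \<ominus>\<^bsub>Y\<^esub> T l)" for n
    using Y.rnorm_le_diff[of "T l" "T (x n)"] T assms(5,6) assms(8)[of n] by simp
  ultimately show ?thesis
    by (intro LIMSEQ_le_const[where X = "\<lambda>n. B + rnorm Y (T (x n) \<ominus>\<^bsub>Y\<^esub> T l)"]) auto
qed

lemma (in F_BC_module) uniform_bound_unit_ball:
  assumes Y: "\<And>s. s \<in> S \<Longrightarrow> hyperbolic_normed_space (Y s)"
    and lin: "\<And>s. s \<in> S \<Longrightarrow> BC_linear X (Y s) (T s)"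
    and cont: "\<And>s. s \<in> S \<Longrightarrow> hyp_continuous X (Y s) (T s)"
    and bdd: "\<And>x. x \<in> carrier X \<Longrightarrow> \<exists>B. \<forall>s\<in>S. rnorm (Y s) (T s x) \<le> B"
  obtains K where "0 \<le> K"
    "\<And>s x. s \<in> S \<Longrightarrow> x \<in> carrier X \<Longrightarrow> hyp_le (hnorm X x) 1 \<Longrightarrow> rnorm (Y s) (T s x) \<le> K"
proof -
  have T: "T s x \<in> carrier (Y s)" if "s \<in> S" "x \<in> carrier X" for s x
    using lin[OF that(1)] that(2) by (auto simp: BC_linear_def)
  define A where "A n = {x \<in> carrier X. \<forall>s\<in>S. rnorm (Y s) (T s x) \<le> real n}" for n :: nat
  have closed: "closedin rmetric.mtopology (A n)" for n
    unfolding rmetric.metric_closedin_iff_sequentially_closed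
  proof (intro conjI allI impI)
    show "A n \<subseteq> carrier X"
      by (auto simp: A_def)
    fix x l
    assume *: "range x \<subseteq> A n \<and> limitin rmetric.mtopology x l sequentially"
    then have x: "x k \<in> carrier X" "s \<in> S \<Longrightarrow> rnorm (Y s) (T s (x k)) \<le> real n" for k s
      by (auto simp: A_def)
    from * have l: "l \<in> carrier X" "hyp_converges X x l"
      by (simp_all add: limitin_rmetric[OF x(1)])
    show "l \<in> A n"
      using l rnorm_sublevel_closed[OF hyperbolic_normed_space_axioms Y lin cont x(1) l x(2)]
      by (simp add: A_def)
  qed
  have "(\<Union>n. A n) = carrier X"
  proof (intro equalityI subsetI)
    fix x
    assume x: "x \<in> carrier X"
    obtain B where B: "\<forall>s\<in>S. rnorm (Y s) (T s x) \<le> B"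
      using bdd[OF x] by blast
    obtain n where "B \<le> real n"
      using real_arch_simple by blast
    with B x have "x \<in> A n"
      by (auto simp: A_def intro: order_trans)
    then show "x \<in> (\<Union>n. A n)"
      by blast
  qed (auto simp: A_def)
  \<comment> \<open>The whole space is its own interior and contains 0, so the union of the
    \<open>A n\<close> has nonempty interior. Baire then excludes that every closed
    \<open>A n\<close> has empty interior.\<close>
  moreover have "rmetric.mtopology interior_of carrier X = carrier X"
    using interior_of_topspace[of rmetric.mtopology] by simp
  ultimately have "rmetric.mtopology interior_of \<Union>(range A) \<noteq> {}"
    using M.zero_closed by auto
  then obtain n where "rmetric.mtopology interior_of A n \<noteq> {}"
    using rmetric.metric_Baire_category_alt[OF mcomplete_rmetric, of "range A"] closed by auto
  then obtain a r where a: "a \<in> carrier X" and r: "0 < r" and ball: "rmetric.mball a r \<subseteq> A n"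
    by (auto simp: rmetric.in_interior_of_mball)
  have aA: "a \<in> A n"
    using a r ball by (meson rmetric.centre_in_mball_iff subsetD)
  \<comment> \<open>Translation to the origin: \<open>T s y\<close> is the difference of
    \<open>T s (a + y)\<close> and \<open>T s a\<close>, and both \<open>a + y\<close> and
    \<open>a\<close> lie in \<open>A n\<close>.\<close>
  have small: "rnorm (Y s) (T s y) \<le> 2 * real n"
    if "s \<in> S" "y \<in> carrier X" "rnorm X y < r" for s y
  proof -
    interpret Y: hyperbolic_normed_space "Y s" by (rule Y) fact
    have "a \<ominus>\<^bsub>X\<^esub> (a \<oplus>\<^bsub>X\<^esub> y) = \<ominus>\<^bsub>X\<^esub> y"
      using a that(2) by (simp add: M.minus_eq M.minus_add M.a_assoc M.r_neg2)
    then have "a \<oplus>\<^bsub>X\<^esub> y \<in> rmetric.mball a r"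
      using a that by (simp add: rdist_eq rnorm_minus)
    then have "a \<oplus>\<^bsub>X\<^esub> y \<in> A n"
      using ball by blast
    moreover have "T s (a \<oplus>\<^bsub>X\<^esub> y) = T s a \<oplus>\<^bsub>Y s\<^esub> T s y"
      using lin[OF that(1)] a that(2) by (simp add: BC_linear_def)
    ultimately have "rnorm (Y s) (T s a \<oplus>\<^bsub>Y s\<^esub> T s y) \<le> real n" "rnorm (Y s) (T s a) \<le> real n"
      using aA that(1) by (auto simp: A_def)
    then show ?thesis
      using Y.rnorm_le_add[of "T s a" "T s y"] T a that by simp
  qed
  \<comment> \<open>On the hyperbolic unit ball both components of the norm are at most 1, so
    \<open>rnorm\<close> is at most 2. Scaling by \<open>r / 3\<close> gives at most
    \<open>2 * r / 3\<close>, strictly below \<open>r\<close>; undoing the scaling turns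
    \<open>2 * n\<close> into \<open>6 * n / r\<close>.\<close>
  have "rnorm (Y s) (T s x) \<le> 6 * real n / r"
    if "s \<in> S" "x \<in> carrier X" "hyp_le (hnorm X x) 1" for s x
  proof -
    interpret Y: hyperbolic_normed_space "Y s" by (rule Y) fact
    have "rnorm X x \<le> 2"
      using that(3) by (simp add: rnorm_def hyp_le_iff)
    have "rnorm X (bc_of_real (r / 3) \<odot>\<^bsub>X\<^esub> x) = r / 3 * rnorm X x"
      using r that(2) rnorm_scaleR[of x "r / 3"] by simp
    also have "\<dots> \<le> r / 3 * 2"
      using r \<open>rnorm X x \<le> 2\<close> by (intro mult_left_mono) auto
    also have "\<dots> < r"
      using r by simp
    finally have "rnorm X (bc_of_real (r / 3) \<odot>\<^bsub>X\<^esub> x) < r" .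
    then have "rnorm (Y s) (T s (bc_of_real (r / 3) \<odot>\<^bsub>X\<^esub> x)) \<le> 2 * real n"
      using that by (intro small) auto
    moreover have "T s (bc_of_real (r / 3) \<odot>\<^bsub>X\<^esub> x) = bc_of_real (r / 3) \<odot>\<^bsub>Y s\<^esub> T s x"
      using lin[OF that(1)] that(2) by (simp add: BC_linear_def)
    ultimately have "r / 3 * rnorm (Y s) (T s x) \<le> 2 * real n"
      using Y.rnorm_scaleR[of "T s x" "r / 3"] T that r by simp
    then show ?thesis
      using r by (simp add: field_simps)
  qed
  then show thesis
    using r by (intro that[of "6 * real n / r"]) auto
qed

section \<open>Hyperbolic bounds for operator norms\<close>

lemma hyp_opnorm_bounds:
  assumes X: "hyperbolic_normed_space X" and Y: "hyperbolic_normed_space Y"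
    and T: "T \<in> carrier X \<rightarrow> carrier Y" and M: "M \<in> hyp"
    and bound: "\<And>x. x \<in> carrier X \<Longrightarrow> hyp_le (hnorm X x) 1 \<Longrightarrow> hyp_le (hnorm Y (T x)) M"
  shows "hyp_opnorm X Y T \<in> hyp_pos" "hyp_le (hyp_opnorm X Y T) M"
proof -
  interpret X: hyperbolic_normed_space X by fact
  interpret Y: hyperbolic_normed_space Y by fact
  define A where "A = {hnorm Y (T x) | x. x \<in> carrier X \<and> hyp_le (hnorm X x) 1}"
  have opnorm: "hyp_opnorm X Y T = hyp_Sup A"
    by (simp only: hyp_opnorm_def A_def)
  have pos: "A \<subseteq> hyp_pos"
    using T Y.hnorm_in_hyp_pos by (auto simp: A_def)
  \<comment> \<open>The zero vector is in the unit ball, so \<open>A\<close> is nonempty. Its image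
    also provides an element of \<open>hyp_pos\<close> below the supremum, which puts the supremum
    itself in \<open>hyp_pos\<close>.\<close>
  have "hyp_le (hnorm X \<zero>\<^bsub>X\<^esub>) 1"
    using X.hnorm_eq_0_iff[of "\<zero>\<^bsub>X\<^esub>"] by (simp add: hyp_le_iff)
  then have a: "hnorm Y (T \<zero>\<^bsub>X\<^esub>) \<in> A"
    unfolding A_def using X.M.zero_closed by blast
  have le: "hyp_le a M" if "a \<in> A" for a
    using that bound by (auto simp: A_def)
  have sup: "hyp_is_sup A (hyp_Sup A)"
    using a pos hyp_pos_subset_hyp by (intro hyp_is_sup_Sup[OF _ _ M le]) auto
  then show "hyp_le (hyp_opnorm X Y T) M"
    using M le by (simp add: hyp_is_sup_def opnorm)
  have "hyp_le (hnorm Y (T \<zero>\<^bsub>X\<^esub>)) (hyp_Sup A)"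
    using sup a by (auto simp: hyp_is_sup_def)
  then show "hyp_opnorm X Y T \<in> hyp_pos"
    using subsetD[OF pos a] by (auto simp: opnorm hyp_le_iff hyp_pos_iff)
qed

theorem theorem4p4:
  fixes X :: "'x hyp_normed"
    and S :: "'s set"
    and Y :: "'s \<Rightarrow> 'y hyp_normed"
    and T :: "'s \<Rightarrow> 'x \<Rightarrow> 'y"
  assumes "F_BC_module X"
    and "\<And>s. s \<in> S \<Longrightarrow> hyperbolic_normed_space (Y s)"
    and "\<And>s. s \<in> S \<Longrightarrow> BC_linear X (Y s) (T s)"
    and "\<And>s. s \<in> S \<Longrightarrow> hyp_continuous X (Y s) (T s)"
    and "\<And>x. x \<in> carrier X \<Longrightarrow> hyp_bounded {hnorm (Y s) (T s x) | s. s \<in> S}"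
  shows "hyp_bounded {hyp_opnorm X (Y s) (T s) | s. s \<in> S}"
proof -
  interpret X: F_BC_module X by fact
  have T: "T s x \<in> carrier (Y s)" if "s \<in> S" "x \<in> carrier X" for s x
    using assms(3)[OF that(1)] that(2) by (auto simp: BC_linear_def)
  have pointwise: "\<exists>B. \<forall>s\<in>S. rnorm (Y s) (T s x) \<le> B" if x: "x \<in> carrier X" for x
  proof -
    obtain M where "\<forall>s\<in>S. hyp_le (hnorm (Y s) (T s x)) M"
      using assms(5)[OF x] by (auto simp: hyp_bounded_def)
    then have "\<forall>s\<in>S. rnorm (Y s) (T s x) \<le> Re (bc_comp1 M) + Re (bc_comp2 M)"
      by (auto simp: rnorm_def hyp_le_iff intro!: add_mono)
    then show ?thesis ..
  qed
  obtain K where K: "0 \<le> K"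
    "\<And>s x. s \<in> S \<Longrightarrow> x \<in> carrier X \<Longrightarrow> hyp_le (hnorm X x) 1 \<Longrightarrow> rnorm (Y s) (T s x) \<le> K"
    using X.uniform_bound_unit_ball[OF assms(2-4) pointwise] by blast
  \<comment> \<open>The sign of \<open>K\<close> is supplied separately because an empty
    \<open>S\<close> leaves no norm from which to infer it.\<close>
  have M: "bc_of_real K \<in> hyp_pos"
    using K(1) by (simp add: hyp_pos_iff)
  \<comment> \<open>Back from the real to the hyperbolic norm: each component is at most the sum of
    the two, hence at most \<open>K\<close>, and both components of \<open>bc_of_real K\<close> are
    \<open>K\<close>.\<close>
  have le: "hyp_le (hnorm (Y s) (T s x)) (bc_of_real K)"
    if "s \<in> S" "x \<in> carrier X" "hyp_le (hnorm X x) 1" for s x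
  proof -
    interpret Y: hyperbolic_normed_space "Y s" by (rule assms(2)) fact
    show ?thesis
      using K(2)[OF that] Y.Re_hnorm_nonneg[OF T[OF that(1,2)]] that T by (simp add: rnorm_def hyp_le_iff)
  qed
  have "hyp_opnorm X (Y s) (T s) \<in> hyp_pos \<and> hyp_le (hyp_opnorm X (Y s) (T s)) (bc_of_real K)"
    if "s \<in> S" for s
    using hyp_opnorm_bounds[OF X.hyperbolic_normed_space_axioms assms(2)[OF that] _ _ le[OF that]]
      T[OF that] M hyp_pos_subset_hyp by (simp add: Pi_def subset_iff)
  then show ?thesis
    unfolding hyp_bounded_def using M by auto
qed

end
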